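(* Let $n\ge 1$, let $Q^n=[0,\infty)^n$ and let $\Phi:Q^n\to[0,\infty)$ be a function such that the function $$\Psi:\mathbb{R}^n\to[0,\infty),\qquad \Psi\Big(\sum_{i=1}^n x_ie_i\Big):=\Phi\Big(\sum_{i=1}^n|x_i|e_i\Big)$$ is a norm on $\mathbb{R}^n$ with a strictly convex norm ball. Let $(X_i,d_i)$, $i=1,\dots,n$, be (nonempty) metric spaces, let $X=\prod_{i=1}^nX_i$, and let $d_\Phi\big((x_1,\dots,x_n),(y_1,\dots,y_n)\big)=\Phi\big(d_1(x_1,y_1),\dots,d_n(x_n,y_n)\big)$. Then $$\mathrm{rank}_M(X,d_\Phi)=\sum_{i=1}^n\mathrm{rank}_M(X_i,d_i).$$
   Context: $e_1,\dots,e_n$ is the standard basis of $\mathbb{R}^n$. A map between metric spaces is called isometric if it preserves distances (it need not be surjective). A real normed vector space $(V,\|\cdot\|)$ is regarded as a metric space with distance $\|v-w\|$. For a metric space $(X,d)$ the Minkowski rank is $\mathrm{rank}_M(X,d) := \sup\{\dim V\}$, the supremum over all real normed vector spaces $(V,\|\cdot\|)$ for which there exists an isometric map $(V,\|\cdot\|)\to (X,d)$. The rank takes values in $\mathbb{N}\cup\{\infty\}$ (with $0\in\mathbb{N}$). *)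

theory Defs
  imports "HOL-Analysis.Analysis" "HOL-Library.Poly_Mapping" "HOL-Library.Extended_Nat"
begin

text \<open>
  The finitely supported functions \<open>'a \<Rightarrow>\<^sub>0 real\<close> form the free real vector space on \<open>'a\<close>;
  they serve below as an ambient space that contains copies of all relevant vector spaces.
\<close>

instantiation poly_mapping :: (type, real_vector) real_vector
begin

definition scaleR_poly_mapping :: "real \<Rightarrow> ('a \<Rightarrow>\<^sub>0 'b) \<Rightarrow> ('a \<Rightarrow>\<^sub>0 'b)"
  where "scaleR_poly_mapping r p = Poly_Mapping.map ((*\<^sub>R) r) p"

lemma lookup_scaleR [simp]: "Poly_Mapping.lookup (r *\<^sub>R p) k = r *\<^sub>R Poly_Mapping.lookup p k"
  by (simp add: scaleR_poly_mapping_def Poly_Mapping.map.rep_eq when_def)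

instance
  by intro_classes
    (auto intro!: poly_mapping_eqI simp: lookup_add scaleR_add_right scaleR_add_left)

end

definition is_norm_on :: "'v::real_vector set \<Rightarrow> ('v \<Rightarrow> real) \<Rightarrow> bool"
  where "is_norm_on V N \<longleftrightarrow>
    subspace V \<and>
    (\<forall>v\<in>V. 0 \<le> N v) \<and>
    (\<forall>v\<in>V. N v = 0 \<longleftrightarrow> v = 0) \<and>
    (\<forall>c. \<forall>v\<in>V. N (c *\<^sub>R v) = \<bar>c\<bar> * N v) \<and>
    (\<forall>v\<in>V. \<forall>w\<in>V. N (v + w) \<le> N v + N w)"

definition strictly_convex :: "'v::{real_vector, topological_space} set \<Rightarrow> bool"
  where "strictly_convex S \<longleftrightarrow>
    (\<forall>x\<in>S. \<forall>y\<in>S. x \<noteq> y \<longrightarrow> open_segment x y \<subseteq> interior S)"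

text \<open>The library function \<^const>\<open>dim\<close> returns 0 on infinite-dimensional subspaces.\<close>

definition edim :: "'v::real_vector set \<Rightarrow> enat"
  where "edim V = (if \<exists>B. finite B \<and> V \<subseteq> span B then enat (dim V) else \<infinity>)"

definition isometric_map ::
  "'v::real_vector set \<Rightarrow> ('v \<Rightarrow> real) \<Rightarrow> 'a set \<Rightarrow> ('a \<Rightarrow> 'a \<Rightarrow> real) \<Rightarrow> ('v \<Rightarrow> 'a) \<Rightarrow> bool"
  where "isometric_map V N M d f \<longleftrightarrow>
    f \<in> V \<rightarrow> M \<and> (\<forall>v\<in>V. \<forall>w\<in>V. d (f v) (f w) = N (v - w))"

text \<open>
  The supremum ranges over all real normed vector spaces up to linear isometry. A normed space
  that maps isometrically into \<open>M\<close> has at most as many points as the type \<open>'a\<close>, so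
  a Hamel basis of it can be indexed by elements of \<open>'a\<close>, and the space is
  a subspace of \<open>'a \<Rightarrow>\<^sub>0 real\<close> up to isomorphism. Lemma \<open>edim_le_minkowski_rank\<close> below
  confirms that normed spaces over any other type do not give anything larger.
\<close>

definition minkowski_rank :: "'a set \<Rightarrow> ('a \<Rightarrow> 'a \<Rightarrow> real) \<Rightarrow> enat"
  where "minkowski_rank M d =
    Sup {edim V | (V :: ('a \<Rightarrow>\<^sub>0 real) set) N. is_norm_on V N \<and> (\<exists>f. isometric_map V N M d f)}"

lemma single_1_inject: "Poly_Mapping.single x (1::real) = Poly_Mapping.single y 1 \<Longrightarrow> x = y"
  by (metis lookup_single_eq lookup_single_not_eq zero_neq_one)

lemma independent_single: "independent ((\<lambda>x. Poly_Mapping.single x (1::real)) ` A)"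
proof -
  let ?s = "\<lambda>x. Poly_Mapping.single x (1::real)"
  have inj: "inj ?s"
    by (rule injI) (rule single_1_inject)
  have False if t: "finite t" "t \<subseteq> ?s ` A" and z: "(\<Sum>v\<in>t. u v *\<^sub>R v) = 0"
    and v: "v \<in> t" "u v \<noteq> 0" for t u v
  proof -
    obtain x where x: "v = ?s x" using t v by auto
    have "Poly_Mapping.lookup (\<Sum>v\<in>t. u v *\<^sub>R v) x = (\<Sum>w\<in>t. u w *\<^sub>R Poly_Mapping.lookup w x)"
      by (simp add: Poly_Mapping.lookup_sum)
    also have "\<dots> = (\<Sum>w\<in>t. if w = v then u v else 0)"
    proof (rule sum.cong)
      fix w assume "w \<in> t"
      then obtain y where "w = ?s y" using t by auto
      then show "u w *\<^sub>R Poly_Mapping.lookup w x = (if w = v then u v else 0)"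
        using x inj_eq[OF inj, of x y] by (cases "x = y") (simp_all add: lookup_single)
    qed simp
    finally show False using z v t by simp
  qed
  then show ?thesis unfolding dependent_explicit by blast
qed

lemma edim_le_minkowski_rank:
  fixes W :: "'v::real_vector set" and M :: "'a set"
  assumes N: "is_norm_on W N" and f: "isometric_map W N M d f"
  shows "edim W \<le> minkowski_rank M d"
proof -
  let ?s = "\<lambda>x. Poly_Mapping.single x (1::real)"
  have W: "subspace W" using N by (simp add: is_norm_on_def)
  obtain B where B: "B \<subseteq> W" "independent B" "W \<subseteq> span B" by (rule basis_exists)
  have WB: "span B = W" using B W by (metis span_minimal subset_antisym)
  have fd: "d (f v) (f w) = N (v - w)" if "v \<in> W" "w \<in> W" for v w
    using f that unfolding isometric_map_def by blast
  have inj_f: "inj_on f W"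
  proof (rule inj_onI)
    fix v w assume vw: "v \<in> W" "w \<in> W" "f v = f w"
    have "N (v - w) = d (f v) (f w)" using fd vw by metis
    also have "\<dots> = N (v - v)" using fd[of v v] vw by metis
    also have "\<dots> = 0" using N W by (simp add: is_norm_on_def subspace_0)
    finally show "v = w"
      using N W vw by (auto simp: is_norm_on_def subspace_diff)
  qed
  define S where "S = (\<lambda>b. ?s (f b)) ` B"
  have inj_s: "inj_on (\<lambda>b. ?s (f b)) B"
  proof (rule inj_onI)
    fix b c assume bc: "b \<in> B" "c \<in> B" "?s (f b) = ?s (f c)"
    then have "f b = f c" by (blast dest: single_1_inject)
    then show "b = c" using inj_f bc B by (meson inj_onD subsetD)
  qed
  have S: "independent S"
    using independent_single[of "f ` B"] by (simp add: S_def image_image)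
  obtain g :: "('a \<Rightarrow>\<^sub>0 real) \<Rightarrow> 'v"
    where g: "linear g" "\<forall>x\<in>S. g x = the_inv_into B (\<lambda>b. ?s (f b)) x"
    using linear_independent_extend[OF S] by blast
  have g_s: "g (?s (f b)) = b" if "b \<in> B" for b
    using that g(2) the_inv_into_f_f[OF inj_s that] by (simp add: S_def)
  have gS: "g ` S = B" using g_s by (force simp: S_def)
  have "inj_on g S" using g_s by (auto simp: S_def inj_on_def)
  then have inj_g: "inj_on g (span S)"
    using linear_inj_on_span_independent_image[OF g(1)] B gS by simp
  have gV: "g ` span S = W"
    using linear_span_image[OF g(1), of S] gS WB by simp
  have g0: "g v = 0 \<longleftrightarrow> v = 0" if "v \<in> span S" for v
    using inj_onD[OF inj_g, of v 0] that linear_0[OF g(1)] by (auto simp: span_zero)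
  have gW: "g v \<in> W" if "v \<in> span S" for v using gV that by blast
  have "is_norm_on (span S) (N \<circ> g)"
    using N gW g0 unfolding is_norm_on_def comp_def
    by (simp add: linear_add[OF g(1)] linear_scale[OF g(1)])
  moreover have "isometric_map (span S) (N \<circ> g) M d (f \<circ> g)"
    using f gW fd by (auto simp: isometric_map_def linear_diff[OF g(1)])
  ultimately have "edim (span S) \<le> minkowski_rank M d"
    unfolding minkowski_rank_def by (intro Sup_upper) blast
  moreover have "edim (span S) = edim W"
  proof -
    have "card S = card B" unfolding S_def by (rule card_image[OF inj_s])
    then have "dim (span S) = dim W"
      using dim_eq_card_independent[OF S] dim_eq_card_independent[OF B(2)] WB
      by (metis dim_span)
    moreover have "(\<exists>C. finite C \<and> span S \<subseteq> span C) \<longleftrightarrow> (\<exists>C. finite C \<and> W \<subseteq> span C)"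
    proof -
      have "(\<exists>C. finite C \<and> span S \<subseteq> span C) \<longleftrightarrow> finite S"
        using independent_span_bound[OF _ S] span_superset[of S] by blast
      moreover have "(\<exists>C. finite C \<and> W \<subseteq> span C) \<longleftrightarrow> finite B"
        using independent_span_bound[OF _ B(2)] B(1,3) by blast
      ultimately show ?thesis
        using finite_image_iff[OF inj_s] by (simp add: S_def)
    qed
    ultimately show ?thesis by (simp add: edim_def)
  qed
  ultimately show ?thesis by simp
qed

definition orthant :: "(real ^ 'n) set"
  where "orthant = {x. \<forall>i. 0 \<le> x $ i}"

definition reflected :: "(real ^ 'n \<Rightarrow> real) \<Rightarrow> real ^ 'n \<Rightarrow> real"
  where "reflected \<Phi> x = \<Phi> (\<chi> i. \<bar>x $ i\<bar>)"

definition product_dist ::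
  "(real ^ 'n \<Rightarrow> real) \<Rightarrow> ('n \<Rightarrow> 'a \<Rightarrow> 'a \<Rightarrow> real) \<Rightarrow> ('n \<Rightarrow> 'a) \<Rightarrow> ('n \<Rightarrow> 'a) \<Rightarrow> real"
  where "product_dist \<Phi> d x y = \<Phi> (\<chi> i. d i (x i) (y i))"

end

theory Submission
  imports Defs
begin

text \<open>
  Let \<open>f = (f\<^sub>1, \<dots>, f\<^sub>n)\<close> be an isometric map of a normed space \<open>V\<close> into the product. On a line, equality
  in the triangle inequality together with strict convexity and strict monotonicity of \<open>\<Phi>\<close> on the
  orthant forces each \<open>d\<^sub>i (f\<^sub>i x) (f\<^sub>i (x + t v))\<close> to be linear in \<open>t > 0\<close>; comparing parallel rays, it is
  independent of \<open>x\<close>. So \<open>d\<^sub>i (f\<^sub>i x) (f\<^sub>i y)\<close> is a seminorm of \<open>x - y\<close>, and \<open>f\<^sub>i\<close> is isometric on a complement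
  \<open>C\<^sub>i\<close> of its kernel. The kernels intersect trivially, hence \<open>V\<close> embeds linearly into the direct sum
  of the \<open>C\<^sub>i\<close>. Conversely, a product of isometric maps is isometric for the \<open>\<Phi>\<close>-combination of the norms.
\<close>

section \<open>Strictly convex and absolute norms\<close>

lemma is_norm_onD:
  assumes "is_norm_on V N"
  shows "subspace V" "v \<in> V \<Longrightarrow> 0 \<le> N v" "v \<in> V \<Longrightarrow> N v = 0 \<longleftrightarrow> v = 0"
    "v \<in> V \<Longrightarrow> N (c *\<^sub>R v) = \<bar>c\<bar> * N v"
    "v \<in> V \<Longrightarrow> w \<in> V \<Longrightarrow> N (v + w) \<le> N v + N w"
  using assms by (simp_all add: is_norm_on_def)

text \<open>If the unit vectors in the directions \<open>p\<close> and \<open>q\<close> differed,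
  the normalized sum \<open>z\<close> would lie strictly between them and hence inside the ball.
  Equality in the triangle inequality, however, puts \<open>z\<close> at norm at least 1.\<close>

lemma strictly_convex_norm_add_eq:
  fixes N :: "'v::real_normed_vector \<Rightarrow> real"
  assumes N: "is_norm_on UNIV N" and sc: "strictly_convex {x. N x \<le> 1}"
    and pq: "N p + N q \<le> N (p + q)" and pos: "0 < N p" "0 < N q"
  shows "N q *\<^sub>R p = N p *\<^sub>R q"
proof (rule ccontr)
  assume neq: "N q *\<^sub>R p \<noteq> N p *\<^sub>R q"
  have scale: "N (c *\<^sub>R x) = \<bar>c\<bar> * N x" for c x
    using is_norm_onD(4)[OF N] by simp
  define s where "s = N p + N q"
  define x where "x = p /\<^sub>R N p"
  define y where "y = q /\<^sub>R N q"
  define z where "z = (p + q) /\<^sub>R s"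
  have s: "0 < s" using pos by (simp add: s_def)
  have p: "p = N p *\<^sub>R x" and q: "q = N q *\<^sub>R y" using pos by (simp_all add: x_def y_def)
  have "x \<noteq> y"
  proof
    assume "x = y"
    then have "N q *\<^sub>R p = N q *\<^sub>R N p *\<^sub>R y" "N p *\<^sub>R q = N p *\<^sub>R N q *\<^sub>R y"
      using p q by simp_all
    then show False using neq by (simp add: mult.commute)
  qed
  moreover have "N x \<le> 1" "N y \<le> 1" using pos by (simp_all add: x_def y_def scale)
  moreover have "z \<in> open_segment x y"
  proof -
    have "N p / s = 1 - N q / s" using s by (simp add: s_def field_simps)
    moreover have "z = (N p / s) *\<^sub>R x + (N q / s) *\<^sub>R y"
      using pos by (simp add: z_def x_def y_def scaleR_add_right field_simps)
    ultimately have "z = (1 - N q / s) *\<^sub>R x + (N q / s) *\<^sub>R y" by simp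
    moreover have "0 < N q / s" "N q / s < 1" using pos s by (simp_all add: s_def)
    ultimately show ?thesis using \<open>x \<noteq> y\<close> unfolding in_segment by blast
  qed
  ultimately have "z \<in> interior {x. N x \<le> 1}"
    using sc unfolding strictly_convex_def by blast
  then obtain e where e: "0 < e" "ball z e \<subseteq> {x. N x \<le> 1}"
    by (auto simp: mem_interior)
  \<comment> \<open>Small enough that \<open>(1 + r) *\<^sub>R z\<close> stays within
    \<open>e\<close> of \<open>z\<close>; the summand 1 keeps the denominator positive whatever
    \<open>z\<close> is.\<close>
  define r where "r = e / (2 * (norm z + 1))"
  have nz: "0 < norm z + 1" by (simp add: add_nonneg_pos)
  have r: "0 < r" using e nz by (simp add: r_def)
  have "r * norm z \<le> e / 2"
    using e(1) nz by (simp add: r_def field_simps)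
  then have "dist z ((1 + r) *\<^sub>R z) < e"
    using e(1) r by (simp add: dist_norm scaleR_add_left)
  then have "N ((1 + r) *\<^sub>R z) \<le> 1" using e(2) by auto
  moreover have "1 \<le> N z"
    using pq s by (simp add: z_def scale s_def pos_le_divide_eq divide_inverse_commute[symmetric] del: scaleR_add_right)
  then have "1 + r \<le> (1 + r) * N z" using r by simp
  ultimately show False using r by (simp add: scale)
qed

text \<open>The norm is invariant under sign changes of coordinates, so shrinking a coordinate
  cannot increase it.\<close>

lemma reflected_mono:
  fixes \<Phi> :: "real ^ 'n \<Rightarrow> real"
  assumes norm: "is_norm_on UNIV (reflected \<Phi>)" and le: "\<And>i. \<bar>u $ i\<bar> \<le> \<bar>w $ i\<bar>"
  shows "reflected \<Phi> u \<le> reflected \<Phi> w"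
proof -
  let ?N = "reflected \<Phi>"
  \<comment> \<open>Induction over the set \<open>S\<close> of coordinates already changed from
    \<open>w\<close> to \<open>u\<close>.\<close>
  have "?N (\<chi> i. if i \<in> S then u $ i else w $ i) \<le> ?N w" for S :: "'n set"
    using finite[of S]
  proof (induction S)
    case empty
    then show ?case by simp
  next
    case (insert j S)
    define z where "z = (\<chi> i. if i \<in> S then u $ i else w $ i)"
    define z' where "z' = (\<chi> i. if i = j then - z $ i else z $ i)"
    \<comment> \<open>If \<open>w $ j = 0\<close>, then \<open>u $ j = 0\<close> by
      \<open>le\<close> and division yields \<open>c = 0\<close>, so both facts below still
      hold.\<close>
    define c where "c = u $ j / w $ j"
    have c: "\<bar>c\<bar> \<le> 1" using le[of j] by (auto simp: c_def divide_le_eq)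
    have cw: "u $ j = c * w $ j" using le[of j] by (auto simp: c_def)
    have "?N z' = ?N z"
      unfolding reflected_def by (rule arg_cong[of _ _ \<Phi>]) (simp add: z'_def vec_eq_iff)
    \<comment> \<open>Shrinking one coordinate is averaging with the reflection in that coordinate.\<close>
    have "(\<chi> i. if i \<in> insert j S then u $ i else w $ i)
        = ((1 + c) / 2) *\<^sub>R z + ((1 - c) / 2) *\<^sub>R z'"
      using insert.hyps cw by (auto simp: vec_eq_iff z_def z'_def field_simps)
    then have "?N (\<chi> i. if i \<in> insert j S then u $ i else w $ i)
        \<le> ?N (((1 + c) / 2) *\<^sub>R z) + ?N (((1 - c) / 2) *\<^sub>R z')"
      using is_norm_onD(5)[OF norm] by simp
    also have "\<dots> = (1 + c) / 2 * ?N z + (1 - c) / 2 * ?N z'"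
      using c is_norm_onD(4)[OF norm] by (simp add: abs_le_iff)
    also have "\<dots> = ?N z" by (simp add: \<open>?N z' = ?N z\<close> field_simps)
    also have "\<dots> \<le> ?N w" using insert.IH by (simp add: z_def)
    finally show ?case .
  qed
  from this[of UNIV] show ?thesis by simp
qed

text \<open>Equal norms give equality in the triangle inequality for \<open>u + w\<close>, since
  this sum dominates \<open>2 *\<^sub>R u\<close>. Strict convexity makes \<open>u\<close> and
  \<open>w\<close> proportional, and the common norm makes them equal.\<close>

lemma reflected_strict_mono:
  fixes \<Phi> :: "real ^ 'n \<Rightarrow> real"
  assumes norm: "is_norm_on UNIV (reflected \<Phi>)"
    and sc: "strictly_convex {x. reflected \<Phi> x \<le> 1}"
    and le: "\<And>i. 0 \<le> u $ i" "\<And>i. u $ i \<le> w $ i"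
    and ge: "reflected \<Phi> w \<le> reflected \<Phi> u"
  shows "u = w"
proof -
  let ?N = "reflected \<Phi>"
  have "\<bar>u $ i\<bar> \<le> \<bar>w $ i\<bar>" for i using le[of i] by simp
  then have eq: "?N u = ?N w" using reflected_mono[OF norm, of u w] ge by (meson order_antisym)
  show ?thesis
  proof (cases "?N u = 0")
    case True
    then have "?N w = 0" by (simp add: eq)
    with True show ?thesis using is_norm_onD(3)[OF norm, of u] is_norm_onD(3)[OF norm, of w] by simp
  next
    case False
    then have pos: "0 < ?N u" using is_norm_onD(2)[OF norm, of u] by simp
    have "?N u + ?N w = ?N (2 *\<^sub>R u)" using eq is_norm_onD(4)[OF norm] by simp
    also have "\<dots> \<le> ?N (u + w)"
    proof (rule reflected_mono[OF norm])
      show "\<bar>(2 *\<^sub>R u) $ i\<bar> \<le> \<bar>(u + w) $ i\<bar>" for i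
        using le[of i] by simp
    qed
    finally have "?N w *\<^sub>R u = ?N u *\<^sub>R w"
      using strictly_convex_norm_add_eq[OF norm sc] pos eq by simp
    then show ?thesis using eq pos by simp
  qed
qed

lemma reflected_orthant: "u \<in> orthant \<Longrightarrow> reflected \<Phi> u = \<Phi> u"
proof -
  assume "u \<in> orthant"
  then have "(\<chi> i. \<bar>u $ i\<bar>) = u" by (simp add: vec_eq_iff orthant_def)
  then show ?thesis by (simp add: reflected_def)
qed

section \<open>Isometric maps into a product\<close>

locale isometry_into_product =
  fixes \<Phi> :: "real ^ 'n \<Rightarrow> real"
    and X :: "'n \<Rightarrow> 'a set"
    and d :: "'n \<Rightarrow> 'a \<Rightarrow> 'a \<Rightarrow> real"
    and V :: "'v::real_vector set"
    and N :: "'v \<Rightarrow> real"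
    and f :: "'v \<Rightarrow> 'n \<Rightarrow> 'a"
  assumes norm: "is_norm_on UNIV (reflected \<Phi>)"
    and strict: "strictly_convex {x. reflected \<Phi> x \<le> 1}"
    and metric: "\<And>i. Metric_space (X i) (d i)"
    and N: "is_norm_on V N"
    and isometric: "isometric_map V N (Pi UNIV X) (product_dist \<Phi> d) f"
begin

text \<open>Keeping all coordinate distances in one vector lets the norm facts on
  \<open>real ^ 'n\<close> act on it directly.\<close>

definition cdist :: "'v \<Rightarrow> 'v \<Rightarrow> real ^ 'n"
  where "cdist x y = (\<chi> i. d i (f x i) (f y i))"

lemma V: "subspace V"
  using is_norm_onD(1)[OF N] .

lemmas V_closed = subspace_0[OF V] subspace_add[OF V] subspace_diff[OF V]
  subspace_scale[OF V] subspace_neg[OF V]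

lemma f_in: "x \<in> V \<Longrightarrow> f x i \<in> X i"
proof -
  assume "x \<in> V"
  then have "f x \<in> Pi UNIV X" using isometric unfolding isometric_map_def by blast
  then show ?thesis by blast
qed

lemma cdist_nonneg: "0 \<le> cdist x y $ i"
  by (simp add: cdist_def Metric_space.nonneg[OF metric])

lemma cdist_commute: "cdist x y = cdist y x"
  unfolding cdist_def by (subst Metric_space.commute[OF metric]) (rule refl)

lemma cdist_refl: "x \<in> V \<Longrightarrow> cdist x x = 0"
  by (simp add: cdist_def vec_eq_iff Metric_space.zero[OF metric f_in f_in])

lemma cdist_triangle:
  "x \<in> V \<Longrightarrow> y \<in> V \<Longrightarrow> z \<in> V \<Longrightarrow> cdist x z $ i \<le> cdist x y $ i + cdist y z $ i"
  by (simp add: cdist_def Metric_space.triangle[OF metric f_in f_in f_in])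

lemma reflected_cdist:
  assumes "x \<in> V" "y \<in> V"
  shows "reflected \<Phi> (cdist x y) = N (x - y)"
proof -
  have "reflected \<Phi> (cdist x y) = \<Phi> (cdist x y)"
    by (rule reflected_orthant) (simp add: orthant_def cdist_nonneg)
  then show ?thesis
    using isometric assms by (simp add: isometric_map_def product_dist_def cdist_def)
qed

lemma reflected_cdist_line:
  assumes "x \<in> V" "v \<in> V" "s \<le> t"
  shows "reflected \<Phi> (cdist (x + s *\<^sub>R v) (x + t *\<^sub>R v)) = (t - s) * N v"
proof -
  have "N ((x + s *\<^sub>R v) - (x + t *\<^sub>R v)) = N ((s - t) *\<^sub>R v)"
    by (simp add: scaleR_diff_left)
  then show ?thesis
    using assms V_closed is_norm_onD(4)[OF N, of v "s - t"] by (simp add: reflected_cdist)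
qed

text \<open>
  Along a line the triangle inequality for \<open>\<Phi>\<close> is an equality, so strict convexity makes
  the coordinate distances proportional to the parameter.
\<close>

lemma cdist_line_split:
  assumes x: "x \<in> V" and v: "v \<in> V" and st: "0 < s" "0 < t"
  shows "cdist x (x + (s + t) *\<^sub>R v) = ((s + t) / s) *\<^sub>R cdist x (x + s *\<^sub>R v)"
proof (cases "v = 0")
  case True
  then show ?thesis using x by (simp add: cdist_refl)
next
  case False
  let ?R = "reflected \<Phi>"
  define p where "p = cdist x (x + s *\<^sub>R v)"
  define q where "q = cdist (x + s *\<^sub>R v) (x + (s + t) *\<^sub>R v)"
  define r where "r = cdist x (x + (s + t) *\<^sub>R v)"
  have pos: "0 < N v" using False v is_norm_onD(2,3)[OF N, of v] by force
  have Rp: "?R p = s * N v" and Rq: "?R q = t * N v" and Rr: "?R r = (s + t) * N v"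
    using reflected_cdist_line[OF x v, of 0 s] reflected_cdist_line[OF x v, of s "s + t"]
      reflected_cdist_line[OF x v, of 0 "s + t"] st by (simp_all add: p_def q_def r_def)
  have r_le: "r $ i \<le> (p + q) $ i" for i
    using cdist_triangle[of x "x + s *\<^sub>R v" "x + (s + t) *\<^sub>R v"] x v V_closed
    by (simp add: p_def q_def r_def)
  have r_nonneg: "0 \<le> r $ i" for i by (simp add: r_def cdist_nonneg)
  have "\<bar>r $ i\<bar> \<le> \<bar>(p + q) $ i\<bar>" for i using r_le[of i] r_nonneg[of i] by simp
  then have "?R r \<le> ?R (p + q)" by (rule reflected_mono[OF norm])
  then have pq: "?R p + ?R q \<le> ?R (p + q)" by (simp add: Rp Rq Rr algebra_simps)
  \<comment> \<open>Together with \<open>r_le\<close> this meets the hypotheses of strict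
    monotonicity, so the triangle inequality is an equality in every coordinate.\<close>
  have "?R (p + q) \<le> ?R r"
    using is_norm_onD(5)[OF norm, of p q] by (simp add: Rp Rq Rr algebra_simps)
  then have rpq: "r = p + q"
    using reflected_strict_mono[OF norm strict r_nonneg r_le] by simp
  have "(t * N v) *\<^sub>R p = (s * N v) *\<^sub>R q"
    using strictly_convex_norm_add_eq[OF norm strict pq] st pos by (simp add: Rp Rq)
  then have "N v *\<^sub>R (t *\<^sub>R p) = N v *\<^sub>R (s *\<^sub>R q)" by (simp only: scaleR_scaleR mult.commute)
  then have "t *\<^sub>R p = s *\<^sub>R q" using pos by (metis less_irrefl scaleR_cancel_left)
  then have "s *\<^sub>R r = (s + t) *\<^sub>R p" by (simp add: rpq algebra_simps)
  then have "(1 / s) *\<^sub>R s *\<^sub>R r = (1 / s) *\<^sub>R (s + t) *\<^sub>R p" by simp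
  then show ?thesis using st by (simp add: p_def r_def)
qed

text \<open>The previous lemma relates two positive parameters through the smaller one, which is
  \<open>s\<close> when \<open>s < 1\<close> and 1 when \<open>1 < s\<close>.\<close>

lemma cdist_line:
  assumes x: "x \<in> V" and v: "v \<in> V" and s: "0 < s"
  shows "cdist x (x + s *\<^sub>R v) = s *\<^sub>R cdist x (x + v)"
proof -
  consider "s < 1" | "s = 1" | "1 < s" by linarith
  then show ?thesis
  proof cases
    case 1
    then have "cdist x (x + v) = (1 / s) *\<^sub>R cdist x (x + s *\<^sub>R v)"
      using cdist_line_split[OF x v s, of "1 - s"] by simp
    then show ?thesis using s by simp
  next
    case 3
    then show ?thesis using cdist_line_split[OF x v, of 1 "s - 1"] by simp
  qed simp
qed

text \<open>The vector \<open>cdist x y\<close> dominates its own restriction to coordinate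
  \<open>i\<close>. This bounds each coordinate distance between parallel rays uniformly.\<close>

lemma cdist_bounded:
  assumes "x \<in> V" "y \<in> V"
  shows "cdist x y $ i * reflected \<Phi> (axis i 1) \<le> N (x - y)"
proof -
  have "cdist x y $ i * reflected \<Phi> (axis i 1) = reflected \<Phi> ((cdist x y $ i) *\<^sub>R axis i 1)"
    by (simp add: is_norm_onD(4)[OF norm] cdist_nonneg)
  also have "\<dots> \<le> reflected \<Phi> (cdist x y)"
    by (rule reflected_mono[OF norm]) (simp add: axis_def)
  finally show ?thesis using assms by (simp add: reflected_cdist)
qed

text \<open>
  Two parallel rays stay at bounded distance, whereas a difference of the coordinate
  distances along them would grow linearly.
\<close>

lemma cdist_translate_le:
  assumes x: "x \<in> V" and y: "y \<in> V" and v: "v \<in> V"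
  shows "cdist x (x + v) $ i \<le> cdist y (y + v) $ i"
proof (rule ccontr)
  define e where "e = cdist x (x + v) $ i - cdist y (y + v) $ i"
  define c where "c = reflected \<Phi> (axis i 1)"
  \<comment> \<open>Chosen so that \<open>t * e * c\<close> exceeds by 1 the bound
    \<open>2 * N (x - y)\<close> coming from the two crossings between the rays.\<close>
  define t where "t = (2 * N (x - y) + 1) / (e * c)"
  assume "\<not> ?thesis"
  then have e: "0 < e" by (simp add: e_def)
  have "c \<noteq> 0" using is_norm_onD(3)[OF norm, of "axis i 1"] by (simp add: c_def axis_eq_0_iff)
  then have c: "0 < c" using is_norm_onD(2)[OF norm, of "axis i 1"] by (simp add: c_def)
  have "0 \<le> N (x - y)" by (simp add: is_norm_onD(2)[OF N] V_closed x y)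
  then have t: "0 < t" using e c by (simp add: t_def)
  have tv: "x + t *\<^sub>R v \<in> V" "y + t *\<^sub>R v \<in> V" by (simp_all add: x y v V_closed)
  \<comment> \<open>Detour: cross from \<open>x\<close> to \<open>y\<close>, follow the ray of
    \<open>y\<close>, and cross back.\<close>
  have "cdist x (x + t *\<^sub>R v) $ i
      \<le> cdist x y $ i + cdist y (y + t *\<^sub>R v) $ i + cdist (y + t *\<^sub>R v) (x + t *\<^sub>R v) $ i"
    using cdist_triangle[of x y "x + t *\<^sub>R v" i]
      cdist_triangle[of y "y + t *\<^sub>R v" "x + t *\<^sub>R v" i] x y tv by simp
  then have "t * e \<le> cdist x y $ i + cdist (x + t *\<^sub>R v) (y + t *\<^sub>R v) $ i"
    using cdist_line[OF x v t] cdist_line[OF y v t] 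
      cdist_commute[of "x + t *\<^sub>R v" "y + t *\<^sub>R v"]
    by (simp add: e_def algebra_simps)
  then have "t * e * c \<le> (cdist x y $ i + cdist (x + t *\<^sub>R v) (y + t *\<^sub>R v) $ i) * c"
    using c by (simp add: mult_right_mono)
  also have "\<dots> \<le> 2 * N (x - y)"
    using cdist_bounded[OF x y, of i] cdist_bounded[OF tv, of i]
    by (simp add: c_def algebra_simps)
  also have "\<dots> < t * e * c" using e c by (simp add: t_def)
  finally show False by simp
qed

lemma cdist_eq:
  assumes "x \<in> V" "y \<in> V"
  shows "cdist x y $ i = cdist 0 (y - x) $ i"
  using cdist_translate_le[of x 0 "y - x" i] cdist_translate_le[of 0 x "y - x" i]
    assms by (simp add: V_closed)

section \<open>Coordinate seminorms and their kernels\<close>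

definition seminorm :: "'n \<Rightarrow> 'v \<Rightarrow> real"
  where "seminorm i v = cdist 0 v $ i"

lemma seminorm_diff: "v \<in> V \<Longrightarrow> w \<in> V \<Longrightarrow> d i (f v i) (f w i) = seminorm i (v - w)"
  using cdist_eq[of w v i] Metric_space.commute[OF metric, of i "f v i" "f w i"]
  by (simp add: seminorm_def cdist_def)

lemma seminorm_nonneg: "0 \<le> seminorm i v"
  by (simp add: seminorm_def cdist_nonneg)

lemma seminorm_0: "seminorm i 0 = 0"
  by (simp add: seminorm_def cdist_refl V_closed)

text \<open>Translating the pair \<open>v\<close>, 0 by \<open>- v\<close> gives the pair 0,
  \<open>- v\<close>; symmetry of the distance does the rest.\<close>

lemma seminorm_minus: "v \<in> V \<Longrightarrow> seminorm i (- v) = seminorm i v"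
  using cdist_eq[of 0 v i] cdist_eq[of v 0 i] cdist_commute[of v 0]
  by (simp add: seminorm_def V_closed)

lemma seminorm_triangle:
  assumes "v \<in> V" "w \<in> V"
  shows "seminorm i (v + w) \<le> seminorm i v + seminorm i w"
  using cdist_triangle[of 0 v "v + w" i] cdist_eq[of v "v + w" i] assms
  by (simp add: seminorm_def V_closed)

lemma seminorm_scale:
  assumes v: "v \<in> V"
  shows "seminorm i (c *\<^sub>R v) = \<bar>c\<bar> * seminorm i v"
proof -
  have pos: "seminorm i (s *\<^sub>R v) = s * seminorm i v" if "0 < s" for s
    using cdist_line[OF _ v that, of 0] by (simp add: seminorm_def V_closed)
  consider "0 < c" | "c = 0" | "c < 0" by linarith
  then show ?thesis
  proof cases
    case 3
    then show ?thesis
      using pos[of "- c"] seminorm_minus[of "c *\<^sub>R v" i] v V_closed by simp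
  qed (simp_all add: pos seminorm_0)
qed

text \<open>The coordinate distances determine \<open>N v\<close>, so the kernels intersect
  trivially. This later yields injectivity of the map into the direct sum.\<close>

lemma all_seminorm_0:
  assumes "v \<in> V" "\<And>i. seminorm i v = 0"
  shows "v = 0"
proof -
  have "cdist v 0 = 0" using assms cdist_commute[of v 0] by (simp add: vec_eq_iff seminorm_def)
  then have "N v = 0"
    using reflected_cdist[of v 0] assms V_closed is_norm_onD(3)[OF norm, of 0] by simp
  then show ?thesis using is_norm_onD(3)[OF N] assms by blast
qed

lemma subspace_seminorm_kernel: "subspace {v \<in> V. seminorm i v = 0}"
proof (rule subspaceI)
  fix v w assume "v \<in> {v \<in> V. seminorm i v = 0}" "w \<in> {v \<in> V. seminorm i v = 0}"
  then show "v + w \<in> {v \<in> V. seminorm i v = 0}"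
    using seminorm_triangle[of v w i] seminorm_nonneg[of i "v + w"] V_closed by simp
qed (simp_all add: seminorm_0 seminorm_scale V_closed)

end

section \<open>Linear algebra\<close>

lemma linear_vec_nth: "linear (\<lambda>v :: 'v::real_vector ^ 'n. v $ i)"
  by (rule linearI) simp_all

lemma linear_axis: "linear (axis i :: 'v::real_vector \<Rightarrow> 'v ^ 'n)"
  by (rule linearI) (simp_all add: vec_eq_iff axis_def)

text \<open>Direct sums are encoded in \<open>'v ^ 'n\<close>, with each \<open>B i\<close> placed
  on its own axis. Projection to coordinate \<open>i\<close> sends the other axes to 0, so a
  dependence would survive inside a single \<open>B i\<close>.\<close>

lemma independent_axis:
  fixes B :: "'n::finite \<Rightarrow> 'v::real_vector set"
  assumes B: "\<And>i. independent (B i)"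
  shows "independent (\<Union>i. axis i ` B i)"
proof
  let ?D = "\<Union>i. axis i ` B i"
  assume "dependent ?D"
  then obtain i b where b: "b \<in> B i" "axis i b \<in> span (?D - {axis i b})"
    unfolding dependent_def by blast
  have "(\<lambda>v. v $ i) (axis i b) \<in> (\<lambda>v. v $ i) ` span (?D - {axis i b})"
    using b(2) by (rule imageI)
  then have "b \<in> span ((\<lambda>v. v $ i) ` (?D - {axis i b}))"
    by (simp add: linear_span_image[OF linear_vec_nth])
  moreover have "(\<lambda>v. v $ i) ` (?D - {axis i b}) \<subseteq> insert 0 (B i - {b})"
  proof
    fix a assume "a \<in> (\<lambda>v. v $ i) ` (?D - {axis i b})"
    then obtain j c where "c \<in> B j" "axis j c \<noteq> axis i b" "a = axis j c $ i" by blast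
    then show "a \<in> insert 0 (B i - {b})" by (cases "j = i") (auto simp: axis_def)
  qed
  ultimately have "b \<in> span (insert 0 (B i - {b}))"
    using span_mono by blast
  then have "b \<in> span (B i - {b})" by simp
  then show False using B[of i] b(1) unfolding dependent_def by blast
qed

lemma span_axis:
  fixes B :: "'n::finite \<Rightarrow> 'v::real_vector set"
  shows "span (\<Union>i. axis i ` B i) = {v. \<forall>i. v $ i \<in> span (B i)}"
proof
  have "subspace {v :: 'v ^ 'n. \<forall>i. v $ i \<in> span (B i)}"
    by (rule subspaceI) (auto simp: span_0 intro: span_add span_scale)
  moreover have "(\<Union>i. axis i ` B i) \<subseteq> {v. \<forall>i. v $ i \<in> span (B i)}"
    by (auto simp: axis_def span_0 intro: span_base)
  ultimately show "span (\<Union>i. axis i ` B i) \<subseteq> {v. \<forall>i. v $ i \<in> span (B i)}"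
    by (simp add: span_minimal)
next
  show "{v. \<forall>i. v $ i \<in> span (B i)} \<subseteq> span (\<Union>i. axis i ` B i)"
  proof
    fix v :: "'v ^ 'n" assume v: "v \<in> {v. \<forall>i. v $ i \<in> span (B i)}"
    have "axis i (v $ i) \<in> span (\<Union>i. axis i ` B i)" for i
    proof -
      have "axis i (v $ i) \<in> axis i ` span (B i)" using v by blast
      then have "axis i (v $ i) \<in> span (axis i ` B i)"
        by (simp add: linear_span_image[OF linear_axis])
      then show ?thesis using span_mono[of "axis i ` B i" "\<Union>i. axis i ` B i"] by blast
    qed
    then have "(\<Sum>i\<in>UNIV. axis i (v $ i)) \<in> span (\<Union>i. axis i ` B i)"
      by (simp add: span_sum)
    moreover have "(\<Sum>i\<in>UNIV. axis i (v $ i)) = v"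
      by (simp add: vec_eq_iff axis_def)
    ultimately show "v \<in> span (\<Union>i. axis i ` B i)" by simp
  qed
qed

lemma card_axis:
  fixes B :: "'n::finite \<Rightarrow> 'v::real_vector set"
  assumes "\<And>i. independent (B i)" and fin: "\<And>i. finite (B i)"
  shows "card (\<Union>i. axis i ` B i) = (\<Sum>i\<in>UNIV. card (B i))"
proof -
  \<comment> \<open>Zero is the only vector that two different axes share.\<close>
  have "0 \<notin> B i" for i using assms(1) dependent_zero by blast
  then have "axis i ` B i \<inter> axis j ` B j = {}" if "i \<noteq> j" for i j
    using that by (auto simp: axis_eq_axis)
  then have "card (\<Union>i. axis i ` B i) = (\<Sum>i\<in>UNIV. card (axis i ` B i))"
    using fin by (intro card_UN_disjoint) auto
  moreover have "card (axis i ` B i) = card (B i)" for i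
    by (rule card_image) (simp add: inj_on_def axis_eq_axis)
  ultimately show ?thesis by simp
qed

text \<open>Extend a basis \<open>B\<close> of \<open>K\<close> to a basis \<open>B'\<close> of
  \<open>V\<close>; the projection \<open>g\<close> kills \<open>B\<close> and fixes the added
  vectors \<open>C\<close>.\<close>

lemma subspace_complement_projection:
  fixes K V :: "'v::real_vector set"
  assumes V: "subspace V" and K: "subspace K" "K \<subseteq> V"
  obtains C g where "independent C" "C \<subseteq> V" "linear g" "g ` V \<subseteq> span C"
    "\<And>v. v \<in> span C \<Longrightarrow> g v = v" "\<And>v. v \<in> V \<Longrightarrow> g v = 0 \<longleftrightarrow> v \<in> K"
proof -
  obtain B where B: "B \<subseteq> K" "independent B" "K \<subseteq> span B" by (rule basis_exists)
  have KB: "span B = K" using B K by (metis span_minimal subset_antisym)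
  obtain B' where B': "B \<subseteq> B'" "B' \<subseteq> V" "independent B'" "V \<subseteq> span B'"
    using maximal_independent_subset_extend[of B V] B K by blast
  define C where "C = B' - B"
  obtain g :: "'v \<Rightarrow> 'v" where g: "linear g" "\<forall>b\<in>B'. g b = (if b \<in> B then 0 else b)"
    using linear_independent_extend[OF B'(3), of "\<lambda>b. if b \<in> B then 0 else b"] by auto
  have gC: "g v = v" if "v \<in> span C" for v
    using that linear_eq_on_span[OF g(1) linear_id, of C v] g(2) by (simp add: C_def)
  have gK: "g v = 0" if "v \<in> K" for v
    using that linear_eq_on_span[OF g(1) linear_zero, of B v] g(2) B'(1) KB by (auto simp: subset_iff)
  have "g ` span B' \<subseteq> span C"
  proof -
    have "g ` B' \<subseteq> span C" using g(2) by (auto simp: C_def span_0 intro: span_base)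
    then show ?thesis by (metis linear_span_image[OF g(1)] span_minimal subspace_span)
  qed
  then have gV: "g ` V \<subseteq> span C" using B'(4) by blast
  \<comment> \<open>This map sends \<open>B'\<close> into \<open>span B\<close>, so
    \<open>v - g v\<close> lies in \<open>K\<close> and \<open>g v = 0\<close> forces
    \<open>v\<close> into \<open>K\<close>.\<close>
  have diff: "linear (\<lambda>v. v - g v)"
    using linear_compose_sub[OF linear_id g(1)] by simp
  have "(\<lambda>v. v - g v) ` span B' \<subseteq> span B"
  proof -
    have "(\<lambda>v. v - g v) ` B' \<subseteq> span B" using g(2) by (auto simp: span_0 intro: span_base)
    then show ?thesis by (metis linear_span_image[OF diff] span_minimal subspace_span)
  qed
  then have "v - g v \<in> K" if "v \<in> V" for v using that B'(4) KB by blast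
  then have "g v = 0 \<longleftrightarrow> v \<in> K" if "v \<in> V" for v using gK that by force
  moreover have "independent C" "C \<subseteq> V"
    using B'(2,3) independent_mono[of B' C] by (auto simp: C_def)
  ultimately show ?thesis using that[of C g] g(1) gV gC by blast
qed

section \<open>Extended dimension and finite independent sets\<close>

lemma edim_span:
  assumes B: "finite B" "independent B"
  shows "edim (span B) = enat (card B)"
  using B by (auto simp: edim_def dim_eq_card_independent)

lemma enat_sum: "enat (\<Sum>i\<in>A. f i) = (\<Sum>i\<in>A. enat (f i))"
  by (simp flip: of_nat_eq_enat)

lemma le_edim_imp_independent:
  assumes "enat m \<le> edim V"
  obtains B where "B \<subseteq> V" "finite B" "independent B" "card B = m"
proof -
  obtain C where C: "C \<subseteq> V" "independent C" "V \<subseteq> span C" by (rule basis_exists)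
  have "\<exists>B. B \<subseteq> C \<and> finite B \<and> card B = m"
  proof (cases "finite C")
    case True
    then have "m \<le> card C"
      using assms C by (auto simp: edim_def basis_card_eq_dim split: if_splits)
    then show ?thesis using obtain_subset_with_card_n[of m C] True finite_subset by metis
  next
    case False
    then show ?thesis using infinite_arbitrarily_large[of C m] by blast
  qed
  then show ?thesis using C that independent_mono by (metis subset_trans)
qed

section \<open>The Minkowski rank of a product\<close>

lemma is_norm_on_subset: "is_norm_on V N \<Longrightarrow> subspace W \<Longrightarrow> W \<subseteq> V \<Longrightarrow> is_norm_on W N"
  unfolding is_norm_on_def by (simp add: subset_iff)

lemma isometric_map_subset: "isometric_map V N M d f \<Longrightarrow> W \<subseteq> V \<Longrightarrow> isometric_map W N M d f"
  unfolding isometric_map_def by (auto simp: subset_iff)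

text \<open>Every finite lower bound on the rank is witnessed by a space of exactly that dimension,
  even if the rank is infinite. This keeps the remaining arguments finite-dimensional.\<close>

lemma enat_le_minkowski_rankE:
  fixes M :: "'a set"
  assumes le: "enat m \<le> minkowski_rank M d" and M: "M \<noteq> {}" "\<And>x. x \<in> M \<Longrightarrow> d x x = 0"
  obtains B :: "('a \<Rightarrow>\<^sub>0 real) set" and N f
  where "finite B" "independent B" "card B = m"
    "is_norm_on (span B) N" "isometric_map (span B) N M d f"
proof (cases m)
  case 0
  \<comment> \<open>The zero space is mapped to an arbitrary point of \<open>M\<close>.\<close>
  obtain x where x: "x \<in> M" using M by blast
  have "is_norm_on (span ({} :: ('a \<Rightarrow>\<^sub>0 real) set)) (\<lambda>_. 0)"
    by (simp add: is_norm_on_def)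
  moreover have "isometric_map (span ({} :: ('a \<Rightarrow>\<^sub>0 real) set)) (\<lambda>_. 0) M d (\<lambda>_. x)"
    using x M by (simp add: isometric_map_def)
  ultimately show ?thesis using that[of "{}"] 0 independent_empty by simp
next
  case (Suc k)
  \<comment> \<open>A value strictly below a supremum is exceeded by some member, and exceeding
    \<open>k\<close> means reaching \<open>m = Suc k\<close>.\<close>
  have "enat k < minkowski_rank M d" using le Suc by (metis enat_ord_simps(2) lessI less_le_trans)
  then obtain V :: "('a \<Rightarrow>\<^sub>0 real) set" and N f
    where V: "enat k < edim V" "is_norm_on V N" "isometric_map V N M d f"
    unfolding minkowski_rank_def less_Sup_iff by blast
  have "enat m \<le> edim V" using V(1) Suc by (metis Suc_ile_eq)
  then obtain B where B: "B \<subseteq> V" "finite B" "independent B" "card B = m"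
    by (rule le_edim_imp_independent)
  have "span B \<subseteq> V" using B(1) is_norm_onD(1)[OF V(2)] by (rule span_minimal)
  then show ?thesis
    using that B V is_norm_on_subset[OF V(2) subspace_span] isometric_map_subset[OF V(3)] by blast
qed

text \<open>The direct sum of the witnessing spaces, normed by \<Phi> of the component norms, maps
  isometrically into the product, coordinate by coordinate.\<close>

lemma sum_enat_le_minkowski_rank_product:
  fixes \<Phi> :: "real ^ 'n \<Rightarrow> real" and X :: "'n \<Rightarrow> 'a set"
  assumes norm: "is_norm_on UNIV (reflected \<Phi>)"
    and metric: "\<And>i. Metric_space (X i) (d i)"
    and nonempty: "\<And>i. X i \<noteq> {}"
    and m: "\<And>i. enat (m i) \<le> minkowski_rank (X i) (d i)"
  shows "enat (\<Sum>i\<in>UNIV. m i) \<le> minkowski_rank (Pi UNIV X) (product_dist \<Phi> d)"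
proof -
  have "\<exists>B :: ('a \<Rightarrow>\<^sub>0 real) set. \<exists>N f. finite B \<and> independent B \<and> card B = m i \<and>
      is_norm_on (span B) N \<and> isometric_map (span B) N (X i) (d i) f" for i
  proof -
    have "\<And>x. x \<in> X i \<Longrightarrow> d i x x = 0" using Metric_space.zero[OF metric] by simp
    from enat_le_minkowski_rankE[OF m nonempty this] show ?thesis by metis
  qed
  then obtain B :: "'n \<Rightarrow> ('a \<Rightarrow>\<^sub>0 real) set" and N f
    where B: "\<And>i. finite (B i)" "\<And>i. independent (B i)" "\<And>i. card (B i) = m i"
      and N: "\<And>i. is_norm_on (span (B i)) (N i)"
      and f: "\<And>i. isometric_map (span (B i)) (N i) (X i) (d i) (f i)"
    by metis
  define D where "D = (\<Union>i. axis i ` B i)"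
  have D: "v $ i \<in> span (B i)" if "v \<in> span D" for v i
    using that by (simp add: D_def span_axis)
  define P where "P v = (\<chi> i. N i (v $ i))" for v :: "('a \<Rightarrow>\<^sub>0 real) ^ 'n"
  have P_nonneg: "0 \<le> P v $ i" if "v \<in> span D" for v i
    using is_norm_onD(2)[OF N D[OF that]] by (simp add: P_def)
  have "is_norm_on (span D) (\<lambda>v. reflected \<Phi> (P v))"
    unfolding is_norm_on_def
  proof (intro conjI ballI allI)
    show "subspace (span D)" by simp
  next
    fix v assume "v \<in> span D"
    show "0 \<le> reflected \<Phi> (P v)" using is_norm_onD(2)[OF norm] by simp
  next
    fix v assume v: "v \<in> span D"
    have "reflected \<Phi> (P v) = 0 \<longleftrightarrow> P v = 0" using is_norm_onD(3)[OF norm] by simp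
    also have "\<dots> \<longleftrightarrow> v = 0" using is_norm_onD(3)[OF N D[OF v]] by (simp add: vec_eq_iff P_def)
    finally show "reflected \<Phi> (P v) = 0 \<longleftrightarrow> v = 0" .
  next
    fix c v assume v: "v \<in> span D"
    have "P (c *\<^sub>R v) = \<bar>c\<bar> *\<^sub>R P v"
      using is_norm_onD(4)[OF N D[OF v]] by (simp add: vec_eq_iff P_def)
    then show "reflected \<Phi> (P (c *\<^sub>R v)) = \<bar>c\<bar> * reflected \<Phi> (P v)"
      using is_norm_onD(4)[OF norm] by simp
  next
    fix v w assume vw: "v \<in> span D" "w \<in> span D"
    \<comment> \<open>The component norms are subadditive, and monotonicity carries this over to
      their combination.\<close>
    have "reflected \<Phi> (P (v + w)) \<le> reflected \<Phi> (P v + P w)"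
    proof (rule reflected_mono[OF norm])
      show "\<bar>P (v + w) $ i\<bar> \<le> \<bar>(P v + P w) $ i\<bar>" for i
        using is_norm_onD(5)[OF N D[OF vw(1)] D[OF vw(2)], of i] P_nonneg[OF span_add[OF vw], of i]
        by (simp add: P_def)
    qed
    also have "\<dots> \<le> reflected \<Phi> (P v) + reflected \<Phi> (P w)"
      using is_norm_onD(5)[OF norm] by simp
    finally show "reflected \<Phi> (P (v + w)) \<le> reflected \<Phi> (P v) + reflected \<Phi> (P w)" .
  qed
  moreover have "isometric_map (span D) (\<lambda>v. reflected \<Phi> (P v)) (Pi UNIV X) (product_dist \<Phi> d)
      (\<lambda>v i. f i (v $ i))"
    unfolding isometric_map_def
  proof (intro conjI ballI)
    show "(\<lambda>v i. f i (v $ i)) \<in> span D \<rightarrow> Pi UNIV X"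
      using f D unfolding isometric_map_def by blast
  next
    fix v w assume vw: "v \<in> span D" "w \<in> span D"
    have "reflected \<Phi> (P (v - w)) = \<Phi> (P (v - w))"
      using P_nonneg[OF span_diff[OF vw]] by (intro reflected_orthant) (simp add: orthant_def)
    moreover have "P (v - w) = (\<chi> i. d i (f i (v $ i)) (f i (w $ i)))"
      using f D vw by (simp add: P_def vec_eq_iff isometric_map_def)
    ultimately show "product_dist \<Phi> d (\<lambda>i. f i (v $ i)) (\<lambda>i. f i (w $ i))
        = reflected \<Phi> (P (v - w))"
      by (simp add: product_dist_def)
  qed
  ultimately have "edim (span D) \<le> minkowski_rank (Pi UNIV X) (product_dist \<Phi> d)"
    by (rule edim_le_minkowski_rank)
  moreover have "finite D" "independent D" "card D = (\<Sum>i\<in>UNIV. m i)"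
    using B independent_axis[OF B(2)] card_axis[OF B(2,1)] by (simp_all add: D_def)
  ultimately show ?thesis by (simp add: edim_span)
qed

text \<open>\<open>V\<close> embeds linearly into the direct sum of complements of the seminorm
  kernels, and each complement is a normed space mapped isometrically into one factor.\<close>

lemma (in isometry_into_product) card_independent_le:
  assumes B: "finite B" "independent B" "B \<subseteq> V"
    and V_span: "V \<subseteq> span B"
  shows "enat (card B) \<le> (\<Sum>i\<in>UNIV. minkowski_rank (X i) (d i))"
proof -
  have "\<exists>C g. independent C \<and> C \<subseteq> V \<and> linear g \<and> g ` V \<subseteq> span C \<and>
      (\<forall>v\<in>span C. g v = v) \<and> (\<forall>v\<in>V. g v = 0 \<longleftrightarrow> seminorm i v = 0)" for i
  proof -
    obtain C g where "independent C" "C \<subseteq> V" "linear g" "g ` V \<subseteq> span C"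
      "\<And>v. v \<in> span C \<Longrightarrow> g v = v"
      "\<And>v. v \<in> V \<Longrightarrow> g v = 0 \<longleftrightarrow> v \<in> {v \<in> V. seminorm i v = 0}"
      by (rule subspace_complement_projection[OF V subspace_seminorm_kernel[of i]]) auto
    then show ?thesis by (intro exI[of _ C] exI[of _ g]) simp
  qed
  then obtain C g where C: "\<And>i. independent (C i)" "\<And>i. C i \<subseteq> V"
    and g: "\<And>i. linear (g i)" "\<And>i. g i ` V \<subseteq> span (C i)"
      "\<And>i v. v \<in> span (C i) \<Longrightarrow> g i v = v" "\<And>i v. v \<in> V \<Longrightarrow> g i v = 0 \<longleftrightarrow> seminorm i v = 0"
    by metis
  have CV: "span (C i) \<subseteq> V" for i using C(2) V by (rule span_minimal)
  have finC: "finite (C i)" for i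
    using independent_span_bound[OF B(1) C(1)] C(2) V_span by blast
  have rank: "enat (card (C i)) \<le> minkowski_rank (X i) (d i)" for i
  proof -
    have V_in: "v \<in> V" if "v \<in> span (C i)" for v using that CV by blast
    \<comment> \<open>Here \<open>g i\<close> is the identity and has the same zeros as the
      seminorm, which is therefore a norm.\<close>
    have "seminorm i v = 0 \<longleftrightarrow> v = 0" if "v \<in> span (C i)" for v
      using g(3,4)[of v i] V_in that by metis
    then have "is_norm_on (span (C i)) (seminorm i)"
      using V_in by (simp add: is_norm_on_def seminorm_nonneg seminorm_scale seminorm_triangle)
    moreover have "isometric_map (span (C i)) (seminorm i) (X i) (d i) (\<lambda>v. f v i)"
      using V_in by (simp add: isometric_map_def f_in seminorm_diff)
    ultimately have "edim (span (C i)) \<le> minkowski_rank (X i) (d i)"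
      by (rule edim_le_minkowski_rank)
    then show ?thesis by (simp add: edim_span finC C(1))
  qed
  \<comment> \<open>A vector of \<open>V\<close> killed by \<open>h\<close> lies in every seminorm
    kernel, hence vanishes.\<close>
  define h where "h v = (\<chi> i. g i v)" for v
  have h: "linear h"
    by (rule linearI) (simp_all add: h_def vec_eq_iff linear_add[OF g(1)] linear_scale[OF g(1)])
  define D where "D = (\<Union>i. axis i ` C i)"
  have BV: "span B \<subseteq> V" using B(3) V by (rule span_minimal)
  have "inj_on h (span B)"
    unfolding linear_inj_on_iff_eq_0[OF h subspace_span]
  proof (intro ballI impI)
    fix v assume "v \<in> span B" "h v = 0"
    then show "v = 0" using BV g(4) all_seminorm_0 by (auto simp: h_def vec_eq_iff)
  qed
  then have "independent (h ` B)" "card (h ` B) = card B"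
    using linear_independent_injective_image[OF h B(2)]
    by (auto intro!: card_image intro: inj_on_subset[OF _ span_superset])
  moreover have "h ` B \<subseteq> span D"
    using g(2) B(3) by (fastforce simp: D_def span_axis h_def)
  moreover have "finite D" using finC by (simp add: D_def)
  ultimately have "card B \<le> card D" using independent_span_bound[of D "h ` B"] by simp
  also have "\<dots> = (\<Sum>i\<in>UNIV. card (C i))" unfolding D_def by (rule card_axis[OF C(1) finC])
  finally have "enat (card B) \<le> (\<Sum>i\<in>UNIV. enat (card (C i)))"
    by (simp flip: enat_sum)
  also have "\<dots> \<le> (\<Sum>i\<in>UNIV. minkowski_rank (X i) (d i))" by (rule sum_mono) (rule rank)
  finally show ?thesis .
qed

section \<open>Reduction to natural numbers and conclusion\<close>

text \<open>An infinite summand can carry all of \<open>k\<close> alone; otherwise the summands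
  themselves serve as \<open>m\<close>, whose sum may exceed \<open>k\<close>.\<close>

lemma enat_le_sumE:
  fixes r :: "'n::finite \<Rightarrow> enat"
  assumes "enat k \<le> (\<Sum>i\<in>UNIV. r i)"
  obtains m where "\<And>i. enat (m i) \<le> r i" "k \<le> (\<Sum>i\<in>UNIV. m i)"
proof (cases "\<exists>j. r j = \<infinity>")
  case True
  then obtain j where j: "r j = \<infinity>" by blast
  define m where "m i = (if i = j then k else 0)" for i
  have "enat (m i) \<le> r i" for i using j by (auto simp: m_def zero_enat_def[symmetric])
  moreover have "k \<le> (\<Sum>i\<in>UNIV. m i)" by (simp add: m_def)
  ultimately show ?thesis using that by blast
next
  case False
  define m where "m i = the_enat (r i)" for i
  have m: "r i = enat (m i)" for i using False by (cases "r i") (simp_all add: m_def del: not_infinity_eq)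
  have "(\<Sum>i\<in>UNIV. r i) = (\<Sum>i\<in>UNIV. enat (m i))" by (rule sum.cong) (simp_all only: m)
  then have "enat k \<le> enat (\<Sum>i\<in>UNIV. m i)" using assms by (simp only: enat_sum)
  then have "k \<le> (\<Sum>i\<in>UNIV. m i)" by simp
  moreover have "enat (m i) \<le> r i" for i by (simp only: m order_refl)
  ultimately show ?thesis using that by blast
qed

lemma enat_le_by_nat:
  assumes le: "\<And>k. enat k \<le> a \<Longrightarrow> enat k \<le> b"
  shows "a \<le> b"
proof (cases b)
  case (enat n)
  \<comment> \<open>If \<open>a\<close> exceeded \<open>n\<close>, it would be at least
    \<open>Suc n\<close>, and then so would \<open>b\<close>.\<close>
  then show ?thesis using le[of "Suc n"] by (cases a) (auto intro: leI simp: Suc_le_eq)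
qed simp

theorem theorem5:
  fixes \<Phi> :: "real ^ 'n \<Rightarrow> real"
    and X :: "'n \<Rightarrow> 'a set"
    and d :: "'n \<Rightarrow> 'a \<Rightarrow> 'a \<Rightarrow> real"
  assumes \<Phi>: "\<Phi> \<in> orthant \<rightarrow> {0..}"
    and norm: "is_norm_on UNIV (reflected \<Phi>)"
    and strict: "strictly_convex {x. reflected \<Phi> x \<le> 1}"
    and metric: "\<And>i. Metric_space (X i) (d i)"
    and nonempty: "\<And>i. X i \<noteq> {}"
  shows "minkowski_rank (Pi UNIV X) (product_dist \<Phi> d) = (\<Sum>i\<in>UNIV. minkowski_rank (X i) (d i))"
proof (rule antisym)
  show "minkowski_rank (Pi UNIV X) (product_dist \<Phi> d) \<le> (\<Sum>i\<in>UNIV. minkowski_rank (X i) (d i))"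
  proof (rule enat_le_by_nat)
    fix k assume k: "enat k \<le> minkowski_rank (Pi UNIV X) (product_dist \<Phi> d)"
    have "Pi UNIV X \<noteq> {}" using nonempty by (simp add: Pi_eq_empty)
    moreover have "product_dist \<Phi> d x x = 0" if "x \<in> Pi UNIV X" for x
    proof -
      have "(\<chi> i. d i (x i) (x i)) = 0"
        using that Metric_space.zero[OF metric] by (auto simp: vec_eq_iff)
      then have "product_dist \<Phi> d x x = reflected \<Phi> 0"
        by (simp add: product_dist_def reflected_orthant orthant_def)
      then show ?thesis using is_norm_onD(3)[OF norm, of 0] by simp
    qed
    ultimately obtain B :: "(('n \<Rightarrow> 'a) \<Rightarrow>\<^sub>0 real) set" and N f
      where B: "finite B" "independent B" "card B = k" "is_norm_on (span B) N"
        "isometric_map (span B) N (Pi UNIV X) (product_dist \<Phi> d) f"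
      by (rule enat_le_minkowski_rankE[OF k])
    \<comment> \<open>The space is replaced by the \<open>k\<close>-dimensional
      \<open>span B\<close>, which meets the finite basis requirement of the upper bound.\<close>
    interpret isometry_into_product \<Phi> X d "span B" N f
      using norm strict metric B by (intro isometry_into_product.intro)
    show "enat k \<le> (\<Sum>i\<in>UNIV. minkowski_rank (X i) (d i))"
      using card_independent_le[OF B(1,2) span_superset] B(3) by simp
  qed
next
  show "(\<Sum>i\<in>UNIV. minkowski_rank (X i) (d i)) \<le> minkowski_rank (Pi UNIV X) (product_dist \<Phi> d)"
  proof (rule enat_le_by_nat)
    fix k assume "enat k \<le> (\<Sum>i\<in>UNIV. minkowski_rank (X i) (d i))"
    then obtain m where m: "\<And>i. enat (m i) \<le> minkowski_rank (X i) (d i)" "k \<le> (\<Sum>i\<in>UNIV. m i)"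
      by (rule enat_le_sumE) blast
    have "enat k \<le> enat (\<Sum>i\<in>UNIV. m i)" using m(2) by simp
    also have "\<dots> \<le> minkowski_rank (Pi UNIV X) (product_dist \<Phi> d)"
      using norm metric nonempty m(1) by (rule sum_enat_le_minkowski_rank_product)
    finally show "enat k \<le> minkowski_rank (Pi UNIV X) (product_dist \<Phi> d)" .
  qed
qed

end
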